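(* For each integer $n\ge 1$, let $\sigma_{n,1}$ be the random part size obtained by the following two-step procedure (Procedure 1): first choose a partition $\lambda$ of $n$ uniformly at random among all $p(n)$ partitions of $n$; then, given $\lambda$, choose $\sigma_{n,1}$ uniformly at random among the distinct part sizes occurring in $\lambda$. Then for every real $t$ with $0<t<\infty$, $$\lim_{n\to\infty}\mathbb{P}\left(\frac{\pi\,\sigma_{n,1}}{\sqrt{6n}}\le t\right)=1-e^{-t}.$$
   Context: A partition $\lambda$ of a positive integer $n$ is a representation $n=\sum_{j=1}^n j m_j$ with non-negative integers $m_j$ (the multiplicity of the part size $j$); $\Lambda(n)$ is the finite set of all partitions of $n$ and $p(n)=|\Lambda(n)|$. For $\lambda\in\Lambda(n)$ let $\alpha_j^{(n)}(\lambda)=m_j$, let $\beta_j^{(n)}(\lambda)=1$ if $\alpha_j^{(n)}(\lambda)>0$ and $\beta_j^{(n)}(\lambda)=0$ otherwise, and let $Y_n(\lambda)=\sum_{j=1}^n\beta_j^{(n)}(\lambda)$ be the number of distinct part sizes in $\lambda$. For real $s\ge 1$ let $Y_{s,n}(\lambda)=\sum_{1\le j\le s}\beta_j^{(n)}(\lambda)$ if $s\le n$ and $Y_{s,n}(\lambda)=Y_n(\lambda)$ if $s>n$. Here $\mathbb{P}$ is the probability measure of the two-step experiment: a pair (partition $\lambda$, selected part size $j$) with $\alpha_j^{(n)}(\lambda)>0$ has probability $\frac{1}{p(n)}\cdot\frac{1}{Y_n(\lambda)}$. Equivalently, for $s\ge 1$, $$\mathbb{P}(\sigma_{n,1}\le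 s)=\frac{1}{p(n)}\sum_{\lambda\in\Lambda(n)}\frac{Y_{s,n}(\lambda)}{Y_n(\lambda)}.$$ *)

theory Defs
  imports "HOL-Probability.Probability"
begin

text \<open>A partition of \<open>n\<close> is given by its multiplicities: \<open>m j\<close> is the number of parts equal
  to \<open>j\<close>.\<close>

definition partitions :: "nat \<Rightarrow> (nat \<Rightarrow> nat) set" where
  "partitions n = {m. (\<forall>j. j \<notin> {1..n} \<longrightarrow> m j = 0) \<and> (\<Sum>j = 1..n. j * m j) = n}"

definition part_sizes :: "(nat \<Rightarrow> nat) \<Rightarrow> nat set" where
  "part_sizes m = {j. m j > 0}"

lemma finite_partitions: "finite (partitions n)"
proof -
  have "partitions n \<subseteq> {m. \<forall>j. (j \<in> {1..n} \<longrightarrow> m j \<in> {0..n}) \<and> (j \<notin> {1..n} \<longrightarrow> m j = 0)}"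
  proof safe
    fix m j
    assume m: "m \<in> partitions n"
    show "m j = 0" if "j \<notin> {1..n}" for j
      using m that by (simp add: partitions_def)
    assume j: "j \<in> {1..n}"
    have "m j \<le> j * m j" using j by simp
    also have "\<dots> \<le> (\<Sum>i = 1..n. i * m i)" using j by (intro member_le_sum) auto
    finally show "m j \<in> {0..n}" using m by (simp add: partitions_def)
  qed
  thus ?thesis by (rule finite_subset) (rule finite_set_of_finite_funs, auto)
qed

lemma partitions_nonempty: "partitions n \<noteq> {}"
proof -
  have "(\<lambda>j. if j = 1 \<and> 1 \<le> n then n else 0) \<in> partitions n"
    by (cases "n = 0") (auto simp: partitions_def if_distrib sum.delta cong: if_cong)
  thus ?thesis by blast
qed

lemma part_sizes_subset: "m \<in> partitions n \<Longrightarrow> part_sizes m \<subseteq> {1..n}"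
  unfolding partitions_def part_sizes_def by fastforce

lemma finite_part_sizes: "m \<in> partitions n \<Longrightarrow> finite (part_sizes m)"
  using part_sizes_subset finite_subset by blast

lemma part_sizes_nonempty:
  assumes "m \<in> partitions n" "n \<ge> 1"
  shows "part_sizes m \<noteq> {}"
proof
  assume "part_sizes m = {}"
  hence "(\<Sum>j = 1..n. j * m j) = 0" by (simp add: part_sizes_def)
  with assms show False by (simp add: partitions_def)
qed

text \<open>For \<open>n \<ge> 1\<close> both sets below are finite and nonempty, so each draw is uniform; for
  \<open>n = 0\<close> the second draw is from the empty set and the distribution is meaningless.\<close>

definition procedure1 :: "nat \<Rightarrow> ((nat \<Rightarrow> nat) \<times> nat) pmf" where
  "procedure1 n = do {
     m \<leftarrow> pmf_of_set (partitions n);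
     j \<leftarrow> pmf_of_set (part_sizes m);
     return_pmf (m, j)
   }"

definition sigma1 :: "(nat \<Rightarrow> nat) \<times> nat \<Rightarrow> nat" where
  "sigma1 = snd"

lemma pmf_procedure1:
  assumes "n \<ge> 1" "m \<in> partitions n" "j \<in> part_sizes m"
  shows "pmf (procedure1 n) (m, j) = 1 / card (partitions n) * (1 / card (part_sizes m))"
proof -
  have inner: "pmf (pmf_of_set (part_sizes m') \<bind> (\<lambda>i. return_pmf (m', i))) (m, j)
      = (if m' = m then 1 / card (part_sizes m) else 0)"
    if "m' \<in> partitions n" for m'
  proof -
    have fin: "finite (part_sizes m')" and ne: "part_sizes m' \<noteq> {}"
      using that assms(1) finite_part_sizes part_sizes_nonempty by blast+
    have "pmf (map_pmf (Pair m') (pmf_of_set (part_sizes m'))) (m, j)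
        = (if m' = m then 1 / card (part_sizes m) else 0)"
    proof (cases "m' = m")
      case True
      have "pmf (map_pmf (Pair m) (pmf_of_set (part_sizes m))) (Pair m j)
          = pmf (pmf_of_set (part_sizes m)) j"
        by (rule pmf_map_inj') (simp add: inj_on_def)
      thus ?thesis using True fin ne assms(3) by simp
    next
      case False
      thus ?thesis by (auto simp: pmf_eq_0_set_pmf)
    qed
    thus ?thesis by (simp add: map_pmf_def)
  qed
  have "pmf (procedure1 n) (m, j)
      = (\<Sum>m'\<in>partitions n. if m' = m then 1 / card (part_sizes m) else 0) / card (partitions n)"
    unfolding procedure1_def
    by (simp add: pmf_bind_pmf_of_set[OF partitions_nonempty finite_partitions] inner
             cong: sum.cong)
  thus ?thesis using assms(2) finite_partitions[of n] by (simp add: sum.delta')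
qed

end

theory Submission
  imports Defs "HOL-Real_Asymp.Real_Asymp"
begin

text \<open>
  Put \<open>x = \<pi> / \<surd>(6n)\<close> and \<open>q = e\<^sup>-\<^sup>x\<close>. If every partition \<open>m\<close> of every size gets a
  weight proportional to \<open>q\<close> to the power of its size, then the events that \<open>j\<close> is a part become
  independent with probabilities \<open>q\<^sup>j\<close>, so a Chernoff bound shows that the number of part sizes
  in \<open>A \<subseteq> {1..n}\<close> deviates from \<open>\<Sum>j\<in>A. q\<^sup>j\<close> by \<open>\<delta>\<surd>n\<close> only with
  probability exponentially small in \<open>\<surd>n\<close>. Conditioning on size \<open>n\<close> costs a factor
  \<open>e\<^sup>o\<^sup>(\<^sup>\<surd>\<^sup>n\<^sup>)\<close> only, because \<open>p(n) \<ge> C exp (a\<surd>n)\<close> for every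
  \<open>a < 2\<pi> / \<surd>6\<close>. Hence the concentration survives for uniform partitions of \<open>n\<close>, and the
  proportion of part sizes up to \<open>t / x\<close> tends to the limit of
  \<open>(\<Sum>j\<le>t/x. q\<^sup>j) / (\<Sum>j\<le>n. q\<^sup>j)\<close>, which is \<open>1 - e\<^sup>-\<^sup>t\<close>.
\<close>

section \<open>Weighted partitions and exponential moments of part counts\<close>

text \<open>Expanding a product of sums over \<open>k \<le> n\<close> yields one nonnegative term
  for every choice of multiplicities up to \<open>n\<close>. The partitions of \<open>n\<close> are
  among these choices, and \<open>w\<close> marks the part sizes in \<open>A\<close>. Each sum is
  then bounded by the full geometric series.\<close>

lemma partitions_generating_function_le:
  fixes q w :: real
  assumes q: "0 < q" "q < 1" and w: "0 \<le> w"
  shows "(\<Sum>m\<in>partitions n. w ^ card (part_sizes m \<inter> A)) * q ^ n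
    \<le> (\<Prod>j=1..n. 1 + (if j \<in> A then w else 1) * (q ^ j / (1 - q ^ j)))"
proof -
  \<comment> \<open>\<open>g j k\<close> is the factor for \<open>k\<close> copies of
    \<open>j\<close>; \<open>w\<close> enters only once for all \<open>k > 0\<close>, since distinct
    sizes are counted.\<close>
  define g where "g j k = (if 0 < k \<and> j \<in> A then w else 1) * q ^ (j * k)" for j k :: nat
  have g0: "0 \<le> g j k" for j k using q w by (simp add: g_def)
  have eq: "w ^ card (part_sizes m \<inter> A) * q ^ n = (\<Prod>j=1..n. g j (restrict m {1..n} j))"
    if m: "m \<in> partitions n" for m
  proof -
    have "(\<Prod>j=1..n. g j (restrict m {1..n} j)) = (\<Prod>j=1..n. g j (m j))"
      by (intro prod.cong) auto
    also have "\<dots> = (\<Prod>j=1..n. if 0 < m j \<and> j \<in> A then w else 1) * (\<Prod>j=1..n. q ^ (j * m j))"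
      unfolding g_def by (rule prod.distrib)
    also have "(\<Prod>j=1..n. q ^ (j * m j)) = q ^ n"
      using m by (simp add: partitions_def flip: power_sum)
    also have "(\<Prod>j=1..n. if 0 < m j \<and> j \<in> A then w else 1) = (\<Prod>j\<in>part_sizes m \<inter> A. w)"
      using part_sizes_subset[OF m]
      by (intro prod.mono_neutral_cong_right) (auto simp: part_sizes_def)
    finally show ?thesis by simp
  qed
  \<comment> \<open>Functions in \<open>Pi\<^sub>E\<close> are \<open>undefined\<close> outside
    \<open>{1..n}\<close>, while partitions vanish there; \<open>restrict\<close> passes from one
    convention to the other without losing information.\<close>
  have inj: "inj_on (\<lambda>m. restrict m {1..n}) (partitions n)"
  proof (rule inj_onI, rule ext)
    fix m m' j assume *: "m \<in> partitions n" "m' \<in> partitions n"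
      and "restrict m {1..n} = restrict m' {1..n}"
    then have "restrict m {1..n} j = restrict m' {1..n} j" by simp
    with * show "m j = m' j" by (cases "j \<in> {1..n}") (auto simp: partitions_def)
  qed
  have le: "m j \<le> n" if m: "m \<in> partitions n" for m j
  proof (cases "j \<in> {1..n}")
    case True
    have "m j \<le> j * m j" using True by simp
    also have "\<dots> \<le> (\<Sum>i = 1..n. i * m i)" using True by (intro member_le_sum) auto
    finally show ?thesis using m by (simp add: partitions_def)
  qed (use m in \<open>auto simp: partitions_def\<close>)
  have "(\<Sum>m\<in>partitions n. w ^ card (part_sizes m \<inter> A)) * q ^ n
      = (\<Sum>m\<in>partitions n. \<Prod>j=1..n. g j (restrict m {1..n} j))"
    by (simp add: sum_distrib_right eq)
  also have "\<dots> = (\<Sum>f\<in>(\<lambda>m. restrict m {1..n}) ` partitions n. \<Prod>j=1..n. g j (f j))"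
    by (subst sum.reindex[OF inj]) simp
  also have "\<dots> \<le> (\<Sum>f\<in>Pi\<^sub>E {1..n} (\<lambda>_. {..n}). \<Prod>j=1..n. g j (f j))"
    using le by (intro sum_mono2 finite_PiE prod_nonneg) (auto simp: g0)
  also have "\<dots> = (\<Prod>j=1..n. \<Sum>k\<le>n. g j k)"
    by (rule prod_sum_PiE[symmetric]) auto
  also have "\<dots> \<le> (\<Prod>j=1..n. 1 + (if j \<in> A then w else 1) * (q ^ j / (1 - q ^ j)))"
  proof (intro prod_mono conjI sum_nonneg g0)
    fix j assume j: "j \<in> {1..n}"
    let ?w = "if j \<in> A then w else 1"
    have qj: "0 < q ^ j" "q ^ j < 1" using q j by (auto simp: power_less_one_iff)
    have "(\<Sum>k\<le>n. g j k) = 1 + (\<Sum>k<n. g j (Suc k))"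
      by (simp add: sum.atMost_shift g_def)
    also have "(\<Sum>k<n. g j (Suc k)) = ?w * (q ^ j * (\<Sum>k<n. (q ^ j) ^ k))"
      by (simp add: g_def sum_distrib_left power_add power_mult)
    also have "(\<Sum>k<n. (q ^ j) ^ k) = (1 - (q ^ j) ^ n) / (1 - q ^ j)"
      using qj by (simp add: sum_gp_strict)
    also have "\<dots> \<le> 1 / (1 - q ^ j)"
      using qj by (intro divide_right_mono) auto
    finally show "(\<Sum>k\<le>n. g j k) \<le> 1 + ?w * (q ^ j / (1 - q ^ j))"
      using qj w by (simp add: mult_left_mono split: if_splits)
  qed
  finally show ?thesis .
qed

text \<open>The geometric series over all \<open>j \<ge> 1\<close> has the value
  \<open>1 / (exp x - 1)\<close>, and \<open>exp x \<ge> 1 + x\<close>.\<close>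

lemma sum_exp_powers_le:
  fixes x :: real
  assumes x: "0 < x" and A: "A \<subseteq> {1..n}"
  shows "(\<Sum>j\<in>A. exp (- x) ^ j) \<le> 1 / x"
proof -
  have "(\<Sum>j\<in>A. exp (- x) ^ j) \<le> (\<Sum>j=1..n. exp (- x) ^ j)"
    using A by (intro sum_mono2) auto
  also have "\<dots> \<le> exp (- x) / (1 - exp (- x))"
    using x by (simp add: sum_gp divide_right_mono)
  also have "\<dots> = 1 / (exp x - 1)"
    using x by (simp add: exp_minus field_simps)
  also have "\<dots> \<le> 1 / x"
  proof (rule divide_left_mono)
    show "x \<le> exp x - 1" using exp_ge_add_one_self[of x] by linarith
    show "0 < (exp x - 1) * x" using x by simp
  qed simp
  finally show ?thesis .
qed

text \<open>The logarithm of the product is the double sum of \<open>exp (- x * j * k) / k\<close>.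
  Summing over \<open>j\<close> first gives at most \<open>1 / (x * k^2)\<close>, and the squares
  then sum to \<open>pi^2 / 6\<close>.\<close>

lemma euler_product_le:
  fixes x :: real
  assumes x: "0 < x"
  shows "(\<Prod>j=1..n. 1 / (1 - exp (- x) ^ j)) \<le> exp (pi\<^sup>2 / (6 * x))"
proof -
  let ?q = "exp (- x)"
  have q: "0 < ?q ^ j" "?q ^ j < 1" if "j \<in> {1..n}" for j
    using x that by (auto simp: power_less_one_iff)
  have s: "(\<lambda>k. (?q ^ j) ^ Suc k / real (Suc k)) sums - ln (1 - ?q ^ j)" if "j \<in> {1..n}" for j
  proof -
    have "\<bar>- (?q ^ j)\<bar> < 1" using q[OF that] by auto
    from ln_series'[OF this] have "(\<lambda>k. - ((?q ^ j) ^ k) / of_nat k) sums ln (1 - ?q ^ j)"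
      by simp
    from sums_minus[OF this] have "(\<lambda>k. (?q ^ j) ^ k / of_nat k) sums - ln (1 - ?q ^ j)"
      by simp
    \<comment> \<open>The term with index 0 is \<open>1 / 0 = 0\<close>, so the series may start at
      1.\<close>
    then show ?thesis by (subst sums_Suc_iff) simp
  qed
  have "(\<lambda>k. \<Sum>j=1..n. (?q ^ j) ^ Suc k / real (Suc k)) sums (\<Sum>j=1..n. - ln (1 - ?q ^ j))"
    by (intro sums_sum s)
  moreover have "(\<lambda>k. (1 / x) * (1 / (real k + 1)\<^sup>2)) sums ((1 / x) * (pi\<^sup>2 / 6))"
    using inverse_squares_sums by (intro sums_mult) (simp add: add_ac)
  moreover have "(\<Sum>j=1..n. (?q ^ j) ^ Suc k / real (Suc k)) \<le> (1 / x) * (1 / (real k + 1)\<^sup>2)" for k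
  proof -
    \<comment> \<open>Exchanging the two exponents gives a geometric sum with
      \<open>x * Suc k\<close> in place of \<open>x\<close>.\<close>
    have "(\<Sum>j=1..n. (?q ^ j) ^ Suc k) = (\<Sum>j=1..n. exp (- (x * Suc k)) ^ j)"
      by (intro sum.cong refl) (simp add: algebra_simps flip: exp_of_nat_mult exp_add)
    also have "\<dots> \<le> 1 / (x * Suc k)"
      using x by (intro sum_exp_powers_le) auto
    finally have "(\<Sum>j=1..n. (?q ^ j) ^ Suc k) / Suc k \<le> 1 / (x * Suc k) / Suc k"
      by (intro divide_right_mono) auto
    then show ?thesis
      by (simp add: sum_divide_distrib power2_eq_square add_ac mult_ac)
  qed
  ultimately have "(\<Sum>j=1..n. - ln (1 - ?q ^ j)) \<le> (1 / x) * (pi\<^sup>2 / 6)"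
    by (meson sums_le)
  then have "exp (\<Sum>j=1..n. - ln (1 - ?q ^ j)) \<le> exp (pi\<^sup>2 / (6 * x))"
    by (simp add: mult_ac)
  also have "exp (\<Sum>j=1..n. - ln (1 - ?q ^ j)) = (\<Prod>j=1..n. 1 / (1 - ?q ^ j))"
    using q by (simp add: exp_sum exp_minus field_simps)
  finally show ?thesis .
qed

text \<open>For \<open>u < 0\<close> put \<open>v = - u\<close>: the quadratic Taylor polynomial of
  \<open>exp v\<close> times \<open>1 - v + v^2\<close> is
  \<open>1 + (v^2 + v^3 + v^4) / 2 \<ge> 1\<close>.\<close>

lemma exp_le_quadratic:
  fixes u :: real
  assumes "\<bar>u\<bar> \<le> 1"
  shows "exp u \<le> 1 + u + u\<^sup>2"
proof (cases "0 \<le> u")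
  case True then show ?thesis using assms by (intro exp_bound) auto
next
  case False
  define v where "v = - u"
  have v: "0 \<le> v" using False by (simp add: v_def)
  have "1 \<le> 1 + (v\<^sup>2 + v ^ 3 + v ^ 4) / 2" using v by simp
  also have "\<dots> = (1 - v + v\<^sup>2) * (1 + v + v\<^sup>2 / 2)"
    by (simp add: power2_eq_square power3_eq_cube power4_eq_xxxx field_simps)
  also have "\<dots> \<le> (1 - v + v\<^sup>2) * exp v"
  proof (rule mult_left_mono)
    have "0 \<le> (1 / 2 - v)\<^sup>2" by simp
    then show "0 \<le> 1 - v + v\<^sup>2" by (simp add: power2_eq_square field_simps)
  qed (rule exp_lower_Taylor_quadratic[OF v])
  finally show ?thesis by (simp add: v_def exp_minus field_simps)
qed

text \<open>The Chernoff moment. For \<open>w = exp u\<close> and \<open>q = exp (- x)\<close>, each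
  factor of the generating function is an Euler factor times the moment
  \<open>1 + (exp u - 1) * q^j\<close> of an indicator with mean \<open>q^j\<close>. Removing the
  weight \<open>q^n\<close> costs \<open>exp (n * x)\<close>; centring at
  \<open>S \<le> 1 / x\<close> leaves \<open>(exp u - 1 - u) * S \<le> u^2 / x\<close>.\<close>

lemma sum_exp_part_count_le:
  fixes x u :: real
  assumes x: "0 < x" and A: "A \<subseteq> {1..n}" and u: "\<bar>u\<bar> \<le> 1"
  defines "S \<equiv> \<Sum>j\<in>A. exp (- x) ^ j"
  shows "(\<Sum>m\<in>partitions n. exp (u * (real (card (part_sizes m \<inter> A)) - S)))
    \<le> exp (pi\<^sup>2 / (6 * x) + n * x + u\<^sup>2 / x)"
proof -
  let ?q = "exp (- x)"
  have q: "0 < ?q ^ j" "?q ^ j < 1" if "j \<in> {1..n}" for j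
    using x that by (auto simp: power_less_one_iff)
  have S: "0 \<le> S" "S \<le> 1 / x"
    using sum_exp_powers_le[OF x A] by (auto simp: S_def intro: sum_nonneg)
  have "(\<Sum>m\<in>partitions n. exp u ^ card (part_sizes m \<inter> A)) * ?q ^ n
      \<le> (\<Prod>j=1..n. 1 + (if j \<in> A then exp u else 1) * (?q ^ j / (1 - ?q ^ j)))"
    using x by (intro partitions_generating_function_le) auto
  also have "\<dots> \<le> (\<Prod>j=1..n. exp (if j \<in> A then (exp u - 1) * ?q ^ j else 0) * (1 / (1 - ?q ^ j)))"
  proof (intro prod_mono conjI)
    fix j assume j: "j \<in> {1..n}"
    note qj = q[OF j]
    show "0 \<le> 1 + (if j \<in> A then exp u else 1) * (?q ^ j / (1 - ?q ^ j))"
      using qj by simp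
    have "1 + (if j \<in> A then exp u else 1) * (?q ^ j / (1 - ?q ^ j))
      = (1 + (if j \<in> A then (exp u - 1) * ?q ^ j else 0)) * (1 / (1 - ?q ^ j))"
      using qj by (simp add: field_simps)
    also have "\<dots> \<le> exp (if j \<in> A then (exp u - 1) * ?q ^ j else 0) * (1 / (1 - ?q ^ j))"
      using qj by (intro mult_right_mono exp_ge_add_one_self) auto
    finally show "1 + (if j \<in> A then exp u else 1) * (?q ^ j / (1 - ?q ^ j)) \<le> \<dots>" .
  qed
  also have "\<dots> = exp (\<Sum>j=1..n. if j \<in> A then (exp u - 1) * ?q ^ j else 0)
      * (\<Prod>j=1..n. 1 / (1 - ?q ^ j))"
    by (simp only: prod.distrib exp_sum finite_atLeastAtMost)
  also have "(\<Sum>j=1..n. if j \<in> A then (exp u - 1) * ?q ^ j else 0) = (exp u - 1) * S"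
    unfolding S_def sum_distrib_left using A
    by (simp add: sum.inter_restrict[symmetric] Int_absorb1 Int_absorb2)
  also have "exp ((exp u - 1) * S) * (\<Prod>j=1..n. 1 / (1 - ?q ^ j))
      \<le> exp ((exp u - 1) * S) * exp (pi\<^sup>2 / (6 * x))"
    using x by (intro mult_left_mono euler_product_le) auto
  finally have *: "(\<Sum>m\<in>partitions n. exp u ^ card (part_sizes m \<inter> A)) * ?q ^ n
      \<le> exp ((exp u - 1) * S) * exp (pi\<^sup>2 / (6 * x))" .
  have "(\<Sum>m\<in>partitions n. exp (u * (real (card (part_sizes m \<inter> A)) - S)))
      = ((\<Sum>m\<in>partitions n. exp u ^ card (part_sizes m \<inter> A)) * ?q ^ n) * exp (n * x - u * S)"
  proof -
    have "exp (u * (real c - S)) = exp u ^ c * (?q ^ n * exp (n * x - u * S))" for c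
      by (simp add: algebra_simps flip: exp_of_nat_mult exp_add)
    then show ?thesis by (simp add: sum_distrib_right mult.assoc)
  qed
  also have "\<dots> \<le> (exp ((exp u - 1) * S) * exp (pi\<^sup>2 / (6 * x))) * exp (n * x - u * S)"
    using * by (intro mult_right_mono) auto
  also have "\<dots> = exp (pi\<^sup>2 / (6 * x) + n * x + (exp u - 1 - u) * S)"
    by (simp add: algebra_simps flip: exp_add)
  also have "\<dots> \<le> exp (pi\<^sup>2 / (6 * x) + n * x + u\<^sup>2 / x)"
  proof -
    have "(exp u - 1 - u) * S \<le> u\<^sup>2 * (1 / x)"
      using S exp_le_quadratic[OF u] by (intro mult_mono) auto
    then show ?thesis by simp
  qed
  finally show ?thesis .
qed

section \<open>Lower bound for the partition numbers\<close>

text \<open>Adding \<open>k\<close> parts of size \<open>v\<close> is an injection.\<close>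

lemma card_partitions_multiplicity_ge:
  assumes "1 \<le> v" "k * v \<le> n"
  shows "card (partitions (n - k * v)) \<le> card {m \<in> partitions n. k \<le> m v}"
proof (cases "k = 0")
  case False
  let ?f = "\<lambda>m::nat\<Rightarrow>nat. m(v := m v + k)"
  \<comment> \<open>Only for \<open>k > 0\<close> does \<open>k * v \<le> n\<close> bound
    \<open>v\<close>, hence the separate case \<open>k = 0\<close>.\<close>
  have vn: "v \<in> {1..n}"
    using assms False by (metis atLeastAtMost_iff dual_order.trans le_0_eq mult_le_mono1
        mult_1 not_less_eq_eq One_nat_def)
  have "?f ` partitions (n - k * v) \<subseteq> {m \<in> partitions n. k \<le> m v}"
  proof safe
    fix m assume m: "m \<in> partitions (n - k * v)"
    have "(\<Sum>j=1..n. j * ?f m j) = (\<Sum>j=1..n. j * m j + (if j = v then v * k else 0))"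
      by (intro sum.cong) (auto simp: algebra_simps)
    also have "\<dots> = (\<Sum>j=1..n. j * m j) + v * k"
      using vn by (simp add: sum.distrib)
    also have "(\<Sum>j=1..n. j * m j) = (\<Sum>j=1..n - k * v. j * m j)"
      using m by (intro sum.mono_neutral_right) (auto simp: partitions_def)
    also have "\<dots> = n - k * v" using m by (simp add: partitions_def)
    finally show "?f m \<in> partitions n"
      using m vn assms by (auto simp: partitions_def mult.commute)
  qed auto
  moreover have "inj_on ?f (partitions (n - k * v))"
  proof (rule inj_onI, rule ext)
    fix m m' j assume "?f m = ?f m'"
    then have "?f m j = ?f m' j" by (rule fun_cong)
    then show "m j = m' j" by (auto split: if_splits)
  qed
  ultimately show ?thesis
    using finite_partitions by (intro card_inj_on_le[where f = ?f]) auto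
qed simp

text \<open>One half of the identity \<open>n p(n) = (\<Sum>k v. v p(n - k v))\<close>, which comes from summing
  \<open>n = (\<Sum>v. v m(v))\<close> over all partitions \<open>m\<close> of \<open>n\<close>.\<close>

lemma partition_recurrence_ge:
  assumes "K * V \<le> n"
  shows "(\<Sum>k=1..K. \<Sum>v=1..V. v * card (partitions (n - k * v))) \<le> n * card (partitions n)"
proof (cases "K = 0")
  case False
  then have V: "V \<le> n" using assms by (metis le_trans mult_le_mono1 mult_1 not_less_eq_eq le_0_eq One_nat_def)
  have "(\<Sum>k=1..K. \<Sum>v=1..V. v * card (partitions (n - k * v)))
      \<le> (\<Sum>k=1..K. \<Sum>v=1..V. v * card {m \<in> partitions n. k \<le> m v})"
  proof (intro sum_mono mult_le_mono2 card_partitions_multiplicity_ge)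
    fix k v assume "k \<in> {1..K}" "v \<in> {1..V}"
    then have "k * v \<le> K * V" by (intro mult_le_mono) auto
    then show "k * v \<le> n" using assms by simp
  qed auto
  also have "\<dots> = (\<Sum>k=1..K. \<Sum>v=1..V. \<Sum>m\<in>partitions n. if k \<le> m v then v else 0)"
    using finite_partitions by (simp add: sum.inter_filter[symmetric] mult.commute)
  also have "\<dots> = (\<Sum>m\<in>partitions n. \<Sum>v=1..V. \<Sum>k=1..K. if k \<le> m v then v else 0)"
    unfolding sum.swap[of _ "{1..K}" "partitions n"] sum.swap[of _ "{1..V}" "partitions n"]
      sum.swap[of _ "{1..V}" "{1..K}"] ..
  also have "\<dots> \<le> (\<Sum>m\<in>partitions n. n)"
  proof (intro sum_mono)
    fix m assume m: "m \<in> partitions n"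
    \<comment> \<open>For each \<open>v\<close>, at most \<open>m v\<close> values of
      \<open>k\<close> contribute.\<close>
    have "(\<Sum>v=1..V. \<Sum>k=1..K. if k \<le> m v then v else 0) \<le> (\<Sum>v=1..V. v * m v)"
    proof (intro sum_mono)
      fix v
      have "(\<Sum>k=1..K. if k \<le> m v then v else 0) = (\<Sum>k\<in>{k\<in>{1..K}. k \<le> m v}. v)"
        by (subst sum.inter_filter) auto
      also have "\<dots> \<le> (\<Sum>k\<in>{1..m v}. v)" by (intro sum_mono2) auto
      finally show "(\<Sum>k=1..K. if k \<le> m v then v else 0) \<le> v * m v" by (simp add: mult.commute)
    qed
    also have "\<dots> \<le> (\<Sum>v=1..n. v * m v)" using V by (intro sum_mono2) auto
    also have "\<dots> = n" using m by (simp add: partitions_def)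
    finally show "(\<Sum>v=1..V. \<Sum>k=1..K. if k \<le> m v then v else 0) \<le> n" .
  qed
  finally show ?thesis by (simp add: mult.commute)
qed simp

text \<open>With \<open>z = y / x\<close> and after division by \<open>sqrt x\<close>, the left side
  is \<open>1 - z / 2 - z^2 / 2 = (1 - z) * (1 + z / 2)\<close>. Squaring reduces the claim to
  \<open>(1 - z) * (1 + z / 2)^2 \<le> 1\<close>.\<close>

lemma sqrt_diff_ge:
  fixes x y :: real
  assumes "0 < x" "0 \<le> y" "y \<le> x"
  shows "sqrt x - y / (2 * sqrt x) - y\<^sup>2 / (2 * x * sqrt x) \<le> sqrt (x - y)"
proof -
  define z where "z = y / x"
  have z: "0 \<le> z" "z \<le> 1" "y = z * x" using assms by (auto simp: z_def)
  have "(1 - z) * ((1 - z) * (1 + z / 2)\<^sup>2) \<le> (1 - z) * 1"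
  proof (rule mult_left_mono)
    have "(1 - z) * (1 + z / 2)\<^sup>2 = 1 - (3 * z\<^sup>2 + z ^ 3) / 4"
      by (simp add: power2_eq_square power3_eq_cube field_simps)
    also have "\<dots> \<le> 1" using z by simp
    finally show "(1 - z) * (1 + z / 2)\<^sup>2 \<le> 1" .
  qed (use z in simp)
  then have "(1 - z) * (1 + z / 2) \<le> sqrt (1 - z)"
    by (intro real_le_rsqrt) (simp add: power_mult_distrib power2_eq_square mult_ac)
  then have "sqrt x * ((1 - z) * (1 + z / 2)) \<le> sqrt x * sqrt (1 - z)"
    using assms by (intro mult_left_mono) auto
  also have "\<dots> = sqrt (x - y)"
    by (simp add: z algebra_simps flip: real_sqrt_mult)
  also have "sqrt x * ((1 - z) * (1 + z / 2)) = sqrt x - y / (2 * sqrt x) - y\<^sup>2 / (2 * x * sqrt x)"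
  proof -
    define r where "r = sqrt x"
    have r: "x = r\<^sup>2" "r > 0" using assms by (auto simp: r_def)
    then show ?thesis unfolding z(3) r_def[symmetric] r(1)
      by (simp add: power2_eq_square field_simps)
  qed
  finally show ?thesis .
qed

lemma sum_mult_power:
  fixes x :: real
  shows "(1 - x)\<^sup>2 * (\<Sum>v=1..V. v * x ^ v) = x * (1 - (V + 1) * x ^ V + V * x ^ (V + 1))"
  by (induction V) (simp_all add: algebra_simps power2_eq_square)

text \<open>A Riemann sum of mesh \<open>1 / sqrt n\<close> for the integral of
  \<open>y * exp (- b * y)\<close> over \<open>y > 0\<close>, which is \<open>1 / b^2\<close>. The
  cut-off \<open>n^(3/5)\<close> outgrows \<open>sqrt n\<close>, so no mass is lost. The limit is
  read off from the closed form \<open>sum_mult_power\<close>.\<close>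

lemma riemann_sum_limit:
  fixes b :: real
  assumes b: "0 < b"
  shows "(\<lambda>n. (\<Sum>v=1..nat \<lfloor>real n powr (3/5)\<rfloor>. v * exp (- b / sqrt n) ^ v) / n) \<longlonglongrightarrow> 1 / b\<^sup>2"
proof -
  define V where "V n = nat \<lfloor>real n powr (3/5)\<rfloor>" for n :: nat
  define x where "x n = exp (- b / sqrt (real n))" for n :: nat
  have V: "real (V n) \<le> real n powr (3/5)" "real n powr (3/5) - 1 \<le> real (V n)" for n
    using powr_ge_zero[of "real n" "3/5"] unfolding V_def by linarith+
  have "(\<lambda>n. x n / (n * (1 - x n)\<^sup>2)) \<longlonglongrightarrow> 1 / b\<^sup>2"
    unfolding x_def inverse_eq_divide[symmetric] using b by real_asymp
  \<comment> \<open>The boundary terms are of order at most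
    \<open>n^(3/5) * exp (- b * n^(1/10))\<close>; the \<open>- 1\<close> in the bound pays for the
    floor.\<close>
  moreover have lim: "(\<lambda>n. (V n + 1) * x n ^ V n) \<longlonglongrightarrow> 0"
  proof (rule tendsto_sandwich[OF _ _ tendsto_const])
    show "(\<lambda>n::nat. (real n powr (3/5) + 1) * exp (- b / sqrt n * (real n powr (3/5) - 1))) \<longlonglongrightarrow> 0"
      using b by real_asymp
    show "\<forall>\<^sub>F n in sequentially. (V n + 1) * x n ^ V n
        \<le> (real n powr (3/5) + 1) * exp (- b / sqrt n * (real n powr (3/5) - 1))"
    proof (intro always_eventually allI mult_mono)
      fix n
      have "x n ^ V n = exp (- b / sqrt n * V n)"
        by (simp add: x_def mult_ac flip: exp_of_nat_mult)
      also have "\<dots> \<le> exp (- b / sqrt n * (real n powr (3/5) - 1))"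
        using V[of n] b by (simp add: mult_left_mono divide_right_mono)
      finally show "x n ^ V n \<le> \<dots>" .
    qed (use V in \<open>auto simp: x_def\<close>)
  qed (auto simp: x_def intro!: always_eventually)
  moreover have "(\<lambda>n. V n * x n ^ (V n + 1)) \<longlonglongrightarrow> 0"
  proof (rule tendsto_sandwich[OF _ _ tendsto_const lim])
    show "\<forall>\<^sub>F n in sequentially. V n * x n ^ (V n + 1) \<le> (V n + 1) * x n ^ V n"
      using b by (intro always_eventually allI mult_mono power_decreasing) (auto simp: x_def)
  qed (auto simp: x_def intro!: always_eventually)
  ultimately have "(\<lambda>n. x n / (n * (1 - x n)\<^sup>2) * (1 - (V n + 1) * x n ^ V n + V n * x n ^ (V n + 1)))
      \<longlonglongrightarrow> 1 / b\<^sup>2 * (1 - 0 + 0)"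
    by (intro tendsto_mult tendsto_add tendsto_diff tendsto_const)
  also have "?this \<longleftrightarrow> ?thesis"
  proof (rule filterlim_cong)
    show "\<forall>\<^sub>F n in sequentially. x n / (n * (1 - x n)\<^sup>2) * (1 - (V n + 1) * x n ^ V n + V n * x n ^ (V n + 1))
      = (\<Sum>v=1..nat \<lfloor>real n powr (3/5)\<rfloor>. v * exp (- b / sqrt n) ^ v) / n"
      using eventually_gt_at_top[of 0]
    proof eventually_elim
      case (elim n)
      then have "x n < 1" using b by (simp add: x_def)
      then have "(\<Sum>v=1..V n. v * x n ^ v) = x n * (1 - (V n + 1) * x n ^ V n + V n * x n ^ (V n + 1)) / (1 - x n)\<^sup>2"
        using sum_mult_power[of "x n" "V n"] by (simp add: field_simps)
      then show ?case using elim by (simp add: V_def x_def)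
    qed
  qed auto
  finally show ?thesis .
qed

lemma card_partitions_ge_one: "1 \<le> card (partitions n)"
  using finite_partitions partitions_nonempty by (simp add: Suc_le_eq card_gt_0_iff)

text \<open>Inserting \<open>exp (a\<surd>m)\<close> for \<open>p(m)\<close> on the right of the recurrence reproduces
  \<open>n exp (a\<surd>n)\<close> with the asymptotic factor \<open>4 / a\<^sup>2 \<cdot> (\<Sum>k\<le>K. 1 / k\<^sup>2)\<close>, which exceeds 1
  for large \<open>K\<close> exactly if \<open>a < 2\<pi> / \<surd>6\<close>; so the bound propagates by induction. Cutting off at
  \<open>v \<le> n\<^bsup>3/5\<^esup>\<close> keeps the quadratic error of \<open>sqrt_diff_ge\<close> negligible.\<close>

lemma card_partitions_lower_bound:
  fixes a :: real
  assumes a: "0 < a" "a < 2 * pi / sqrt 6"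
  shows "\<exists>C>0. \<forall>n. C * exp (a * sqrt n) \<le> card (partitions n)"
proof -
  define V where "V n = nat \<lfloor>real n powr (3/5)\<rfloor>" for n :: nat
  have V: "real (V n) \<le> real n powr (3/5)" for n
    unfolding V_def by simp
  have "a\<^sup>2 < (2 * pi / sqrt 6)\<^sup>2" using a by (intro power_strict_mono) auto
  then have "a\<^sup>2 / 4 < pi\<^sup>2 / 6" by (simp add: power_divide power_mult_distrib)
  moreover have "(\<lambda>K. \<Sum>k<K. 1 / (real k + 1)\<^sup>2) \<longlonglongrightarrow> pi\<^sup>2 / 6"
    using inverse_squares_sums unfolding sums_def by (simp add: add_ac)
  ultimately have "\<forall>\<^sub>F K in sequentially. a\<^sup>2 / 4 < (\<Sum>k<K. 1 / (real k + 1)\<^sup>2)"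
    by (intro order_tendstoD(1))
  then obtain K where "a\<^sup>2 / 4 < (\<Sum>k<K. 1 / (real k + 1)\<^sup>2)"
    by (auto simp: eventually_sequentially)
  also have "\<dots> = (\<Sum>k=1..K. 1 / (real k)\<^sup>2)"
    by (rule sum.reindex_bij_witness[of _ "\<lambda>k. k - 1" Suc]) (auto simp: add_ac)
  finally have K: "1 < 4 / a\<^sup>2 * (\<Sum>k=1..K. 1 / (real k)\<^sup>2)"
    using a by (simp add: field_simps)
  \<comment> \<open>\<open>T n\<close> is the factor gained over \<open>n * exp (a * sqrt n)\<close>
    in the induction step. Its first factor is the worst quadratic error over
    \<open>k \<le> K\<close>, \<open>v \<le> V n\<close>, with exponent of order
    \<open>n^(-3/10)\<close>; the sums over \<open>v\<close> converge by
    \<open>riemann_sum_limit\<close> at \<open>b = a * k / 2\<close>.\<close>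
  define T where "T n = exp (- (a * (real K)\<^sup>2 * (real n powr (3/5))\<^sup>2 / (2 * real n * sqrt n))) *
     (\<Sum>k=1..K. (\<Sum>v=1..V n. v * exp (- (a * real k / 2) / sqrt n) ^ v) / n)" for n :: nat
  have "(\<lambda>n. exp (- (a * (real K)\<^sup>2 * (real n powr (3/5))\<^sup>2 / (2 * real n * sqrt n)))) \<longlonglongrightarrow> 1"
  proof -
    have "(\<lambda>n::nat. a * (real K)\<^sup>2 * ((real n powr (3/5))\<^sup>2 / (2 * real n * sqrt n))) \<longlonglongrightarrow> a * (real K)\<^sup>2 * 0"
      by (intro tendsto_intros) real_asymp
    from tendsto_exp[OF tendsto_minus[OF this]] show ?thesis
      by (simp only: mult_zero_right minus_zero exp_zero times_divide_eq_right)
  qed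
  then have "T \<longlonglongrightarrow> 1 * (\<Sum>k=1..K. 1 / (a * real k / 2)\<^sup>2)"
    unfolding T_def V_def using a by (intro tendsto_mult tendsto_sum riemann_sum_limit) auto
  moreover have "(1::real) < 1 * (\<Sum>k=1..K. 1 / (a * real k / 2)\<^sup>2)"
    using K by (simp add: sum_distrib_left power_divide power_mult_distrib)
  ultimately have "\<forall>\<^sub>F n in sequentially. 1 < T n" by (intro order_tendstoD(1))
  moreover have "\<forall>\<^sub>F n::nat in sequentially. real K * real n powr (3/5) \<le> n"
    by real_asymp
  ultimately have "\<forall>\<^sub>F n in sequentially. 1 < T n \<and> real K * real n powr (3/5) \<le> n \<and> 0 < n"
    using eventually_gt_at_top[of 0] by eventually_elim auto
  then obtain N where N: "\<And>n. n \<ge> N \<Longrightarrow> 1 < T n \<and> real K * real n powr (3/5) \<le> n \<and> 0 < n"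
    by (auto simp: eventually_sequentially)
  \<comment> \<open>This constant makes the claim trivial for \<open>n < N\<close>, where
    \<open>card (partitions n) \<ge> 1\<close> suffices.\<close>
  define C where "C = exp (- (a * sqrt N))"
  have "C * exp (a * sqrt n) \<le> card (partitions n)" for n
  proof (induction n rule: less_induct)
    case (less n)
    show ?case
    proof (cases "n < N")
      case True
      then have "C * exp (a * sqrt n) \<le> 1"
        using a by (simp add: C_def flip: exp_add)
      then show ?thesis using card_partitions_ge_one[of n] by linarith
    next
      case False
      then have n: "1 < T n" "real K * real n powr (3/5) \<le> n" "0 < n" using N by auto
      have "real (K * V n) \<le> real K * real n powr (3/5)" using V by (simp add: mult_left_mono)
      then have KV: "K * V n \<le> n" using n by linarith
      have "n * (C * exp (a * sqrt n)) \<le> n * (C * exp (a * sqrt n)) * T n"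
        using n by (simp add: C_def)
      also have "\<dots> = (\<Sum>k=1..K. \<Sum>v=1..V n. v * (C * exp (a * (sqrt n - k * v / (2 * sqrt n)
          - (real K * real n powr (3/5))\<^sup>2 / (2 * real n * sqrt n)))))"
      proof -
        define D where "D = (real K * real n powr (3/5))\<^sup>2 / (2 * real n * sqrt n)"
        have "exp (a * (sqrt n - k * v / (2 * sqrt n) - D))
          = exp (a * sqrt n) * exp (- (a * D)) * exp (- (a * real k / 2) / sqrt n) ^ v" for k v :: nat
          by (simp add: algebra_simps flip: exp_of_nat_mult exp_add)
        moreover have "T n = exp (- (a * D)) *
            (\<Sum>k=1..K. (\<Sum>v=1..V n. v * exp (- (a * real k / 2) / sqrt n) ^ v) / n)"
          by (simp add: T_def D_def power_mult_distrib mult.assoc)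
        ultimately show ?thesis using n unfolding D_def[symmetric]
          by (simp add: sum_distrib_left sum_divide_distrib mult_ac)
      qed
      also have "\<dots> \<le> (\<Sum>k=1..K. \<Sum>v=1..V n. v * real (card (partitions (n - k * v))))"
      proof (intro sum_mono mult_left_mono)
        fix k v assume kv: "k \<in> {1..K}" "v \<in> {1..V n}"
        then have "k * v \<le> K * V n" by (intro mult_le_mono) auto
        then have kvn: "k * v \<le> n" using KV by simp
        have "real k * real v \<le> real K * real n powr (3/5)"
          using kv V[of n] by (intro mult_mono) auto
        then have "(real (k * v))\<^sup>2 \<le> (real K * real n powr (3/5))\<^sup>2"
          by (intro power_mono) auto
        then have "(real (k * v))\<^sup>2 / (2 * real n * sqrt n) \<le> (real K * real n powr (3/5))\<^sup>2 / (2 * real n * sqrt n)"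
          by (intro divide_right_mono) auto
        moreover have "sqrt n - real (k * v) / (2 * sqrt n) - (real (k * v))\<^sup>2 / (2 * real n * sqrt n)
            \<le> sqrt (real n - real (k * v))"
          using n kvn by (intro sqrt_diff_ge) (auto simp del: of_nat_mult)
        ultimately have "sqrt n - k * v / (2 * sqrt n) - (real K * real n powr (3/5))\<^sup>2 / (2 * real n * sqrt n)
            \<le> sqrt (real (n - k * v))"
          using kvn by (simp add: of_nat_diff)
        then have "C * exp (a * (sqrt n - k * v / (2 * sqrt n)
          - (real K * real n powr (3/5))\<^sup>2 / (2 * real n * sqrt n))) \<le> C * exp (a * sqrt (real (n - k * v)))"
          using a by (intro mult_left_mono) (auto simp: C_def)
        also have "\<dots> \<le> card (partitions (n - k * v))"
          using kv n by (intro less) auto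
        finally show "C * exp (a * (sqrt n - k * v / (2 * sqrt n)
          - (real K * real n powr (3/5))\<^sup>2 / (2 * real n * sqrt n))) \<le> card (partitions (n - k * v))" .
      qed auto
      also have "\<dots> = real (\<Sum>k=1..K. \<Sum>v=1..V n. v * card (partitions (n - k * v)))" by simp
      also have "\<dots> \<le> real (n * card (partitions n))"
        using partition_recurrence_ge[OF KV] by (simp only: of_nat_le_iff)
      finally show ?thesis using n by simp
    qed
  qed
  moreover have "C > 0" by (simp add: C_def)
  ultimately show ?thesis by blast
qed

section \<open>Concentration of part counts in uniform partitions\<close>

text \<open>Markov's inequality for the exponential moments at \<open>u\<close> and
  \<open>- u\<close> leaves at most
  \<open>2 * exp ((2 * pi / sqrt 6 + u^2 - u * \<delta>) * sqrt n)\<close> exceptional partitions,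
  to be compared with \<open>card_partitions_lower_bound\<close>. The estimate does not depend on
  \<open>A\<close>, so one threshold for \<open>n\<close> serves all \<open>A\<close>.\<close>

lemma part_count_concentration:
  fixes \<delta> \<epsilon> :: real
  assumes \<delta>: "0 < \<delta>" and \<epsilon>: "0 < \<epsilon>"
  shows "\<forall>\<^sub>F n in sequentially. \<forall>A\<subseteq>{1..n}.
    card {m \<in> partitions n. \<delta> * sqrt n \<le> \<bar>real (card (part_sizes m \<inter> A))
       - (\<Sum>j\<in>A. exp (- pi / sqrt (6 * real n)) ^ j)\<bar>} \<le> \<epsilon> * card (partitions n)"
proof -
  \<comment> \<open>\<open>u \<le> \<delta> / 2\<close> gives
    \<open>u^2 - u * \<delta> \<le> - u^2\<close>; \<open>u \<le> 1\<close> is the range of the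
    moment bound.\<close>
  define u where "u = min 1 (\<delta> / 2)"
  have u: "0 < u" "u \<le> 1" "2 * u \<le> \<delta>" using \<delta> by (auto simp: u_def)
  \<comment> \<open>Half of the gain \<open>u^2\<close> pays for \<open>a\<close> lying below the
    critical \<open>2 * pi / sqrt 6\<close>, the other half gives the decay. The cap at 1 yields
    \<open>0 < a\<close>, as the critical value exceeds 2.\<close>
  define a where "a = 2 * pi / sqrt 6 - min 1 (u\<^sup>2 / 2)"
  have "sqrt 6 < sqrt (3\<^sup>2)" by (subst real_sqrt_less_iff) simp
  then have s6: "0 < sqrt 6" "sqrt 6 < 3" "sqrt 6 * sqrt 6 = 6" by auto
  then have "2 < 2 * pi / sqrt 6" using pi_gt3 by (simp add: field_simps)
  moreover have "min 1 (u\<^sup>2 / 2) \<le> 1" "0 < min 1 (u\<^sup>2 / 2)" using u by auto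
  ultimately have a: "0 < a" "a < 2 * pi / sqrt 6" unfolding a_def by linarith+
  obtain C where C: "0 < C" "\<And>n. C * exp (a * sqrt n) \<le> card (partitions n)"
    using card_partitions_lower_bound[OF a] by blast
  have "(\<lambda>n. 2 * exp (- (u\<^sup>2 / 2) * sqrt (real n))) \<longlonglongrightarrow> 0"
    using u by real_asymp
  moreover have "0 < \<epsilon> * C" using \<epsilon> C by simp
  ultimately have "\<forall>\<^sub>F n::nat in sequentially. 2 * exp (- (u\<^sup>2 / 2) * sqrt n) < \<epsilon> * C"
    by (intro order_tendstoD(2))
  then show ?thesis
    using eventually_gt_at_top[of 0]
  proof eventually_elim
    case (elim n)
    show ?case
    proof (intro allI impI)
      fix A assume A: "A \<subseteq> {1..n}"
      define x where "x = pi / sqrt (6 * real n)"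
      define Z where "Z m = real (card (part_sizes m \<inter> A)) - (\<Sum>j\<in>A. exp (- x) ^ j)" for m
      define B where "B = {m \<in> partitions n. \<delta> * sqrt n \<le> \<bar>Z m\<bar>}"
      have x: "0 < x" using elim by (simp add: x_def)
      have nn: "sqrt n * sqrt n = n" "0 < sqrt n" using elim by auto
      have x6: "x = pi / (sqrt 6 * sqrt n)" by (simp add: x_def real_sqrt_mult)
      \<comment> \<open>To be read with \<open>r = sqrt n\<close>, \<open>s = sqrt 6\<close>: this
        \<open>x\<close> minimises \<open>pi^2 / (6 * x) + n * x\<close>, and there both terms are
        equal.\<close>
      have "r * r * (pi / (s * r)) = pi / s * r" "pi\<^sup>2 / ((s * s) * (pi / (s * r))) = pi / s * r"
        if "0 < s" "0 < r" for r s :: real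
        using that by (simp_all add: power2_eq_square)
      from this[OF s6(1) nn(2)] have xs: "pi\<^sup>2 / (6 * x) + n * x = 2 * pi / sqrt 6 * sqrt n"
        unfolding s6(3) nn(1) x6 by simp
      have xs': "1 / x \<le> sqrt n"
        using nn s6 pi_gt3 unfolding x6 by (simp add: divide_le_eq mult.commute)
      have bound: "(\<Sum>m\<in>partitions n. exp (v * Z m)) \<le> exp ((2 * pi / sqrt 6 + u\<^sup>2) * sqrt n)"
        if "\<bar>v\<bar> = u" for v
      proof -
        have v: "v\<^sup>2 = u\<^sup>2" using that by (metis power2_abs)
        have "(\<Sum>m\<in>partitions n. exp (v * Z m)) \<le> exp (pi\<^sup>2 / (6 * x) + n * x + v\<^sup>2 / x)"
          unfolding Z_def using that u by (intro sum_exp_part_count_le x A) auto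
        also have "\<dots> \<le> exp ((2 * pi / sqrt 6 + u\<^sup>2) * sqrt n)"
          using mult_left_mono[OF xs', of "u\<^sup>2"] unfolding xs v by (simp add: distrib_right)
        finally show ?thesis .
      qed
      have "card B * exp (u * \<delta> * sqrt n) = (\<Sum>m\<in>B. exp (u * \<delta> * sqrt n))" by simp
      also have "\<dots> \<le> (\<Sum>m\<in>B. exp (u * Z m) + exp (- u * Z m))"
      proof (intro sum_mono)
        fix m assume "m \<in> B"
        then have "u * (\<delta> * sqrt n) \<le> u * \<bar>Z m\<bar>" using u by (auto simp: B_def)
        then have "exp (u * \<delta> * sqrt n) \<le> exp (u * \<bar>Z m\<bar>)" by (simp add: mult.assoc)
        also have "\<dots> \<le> exp (u * Z m) + exp (- u * Z m)" by (cases "0 \<le> Z m") auto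
        finally show "exp (u * \<delta> * sqrt n) \<le> exp (u * Z m) + exp (- u * Z m)" .
      qed
      also have "\<dots> \<le> (\<Sum>m\<in>partitions n. exp (u * Z m) + exp (- u * Z m))"
        using finite_partitions by (intro sum_mono2) (auto simp: B_def add_nonneg_nonneg)
      also have "\<dots> \<le> 2 * exp ((2 * pi / sqrt 6 + u\<^sup>2) * sqrt n)"
        using bound[of u] bound[of "- u"] u by (simp add: sum.distrib)
      finally have "card B \<le> 2 * exp ((2 * pi / sqrt 6 + u\<^sup>2) * sqrt n) / exp (u * \<delta> * sqrt n)"
        by (simp add: field_simps)
      also have "\<dots> = 2 * exp ((2 * pi / sqrt 6 + u\<^sup>2 - u * \<delta>) * sqrt n)"
        by (simp add: left_diff_distrib exp_diff)
      also have "\<dots> \<le> 2 * exp ((a - u\<^sup>2 / 2) * sqrt n)"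
      proof -
        have "u * (2 * u) \<le> u * \<delta>" using u by (intro mult_left_mono) auto
        moreover have "min 1 (u\<^sup>2 / 2) \<le> u\<^sup>2 / 2" by simp
        ultimately have "2 * pi / sqrt 6 + u\<^sup>2 - u * \<delta> \<le> a - u\<^sup>2 / 2"
          by (simp add: a_def power2_eq_square)
        then show ?thesis using nn by (simp add: mult_right_mono)
      qed
      also have "\<dots> = 2 * exp (- (u\<^sup>2 / 2) * sqrt n) * exp (a * sqrt n)"
        by (simp add: algebra_simps flip: exp_add)
      also have "\<dots> \<le> \<epsilon> * C * exp (a * sqrt n)"
        using elim by (intro mult_right_mono) auto
      also have "\<dots> \<le> \<epsilon> * card (partitions n)"
        using C(2)[of n] \<epsilon> by (simp add: mult.assoc)
      finally show "card {m \<in> partitions n. \<delta> * sqrt n \<le> \<bar>real (card (part_sizes m \<inter> A))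
       - (\<Sum>j\<in>A. exp (- pi / sqrt (6 * real n)) ^ j)\<bar>} \<le> \<epsilon> * card (partitions n)"
        by (simp add: B_def Z_def x_def)
    qed
  qed
qed

section \<open>Law of the selected part size\<close>

text \<open>Conditioning on the partition drawn first; \<open>1 \<le> n\<close> makes every set of
  part sizes nonempty, so the second draw is uniform.\<close>

lemma prob_procedure1_sigma1:
  assumes "1 \<le> n"
  shows "measure_pmf.prob (procedure1 n) {\<omega>. sigma1 \<omega> \<in> A}
    = (\<Sum>m\<in>partitions n. card (part_sizes m \<inter> A) / card (part_sizes m)) / card (partitions n)"
proof -
  have "measure_pmf.prob (procedure1 n) {\<omega>. sigma1 \<omega> \<in> A}
      = measure_pmf.prob (map_pmf sigma1 (procedure1 n)) A"
    by (simp add: measure_map_pmf vimage_def)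
  also have "map_pmf sigma1 (procedure1 n)
      = pmf_of_set (partitions n) \<bind> (\<lambda>m. pmf_of_set (part_sizes m))"
    by (simp add: procedure1_def sigma1_def map_bind_pmf bind_return_pmf')
  also have "measure_pmf.prob \<dots> A
      = (\<Sum>m\<in>partitions n. measure_pmf.prob (pmf_of_set (part_sizes m)) A) / card (partitions n)"
  proof -
    have "finite (set_pmf (pmf_of_set (part_sizes m)))" if "m \<in> partitions n" for m
      using that assms finite_part_sizes part_sizes_nonempty by simp
    from pmf_expectation_bind_pmf_of_set[OF partitions_nonempty finite_partitions this,
        where h = "indicator A :: nat \<Rightarrow> real"]
    show ?thesis
      by (simp add: sum_divide_distrib field_simps)
  qed
  also have "(\<Sum>m\<in>partitions n. measure_pmf.prob (pmf_of_set (part_sizes m)) A)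
      = (\<Sum>m\<in>partitions n. card (part_sizes m \<inter> A) / card (part_sizes m))"
    using assms by (intro sum.cong refl measure_pmf_of_set part_sizes_nonempty finite_part_sizes)
  finally show ?thesis .
qed

text \<open>The difference equals \<open>((a - s) - (s / t) * (b - t)) / b\<close> with
  \<open>s / t\<close> between 0 and 1. This carries concentration of counts over to
  proportions.\<close>

lemma ratio_diff_le:
  fixes a b s t d :: real
  assumes "0 < b" "0 < t" "0 \<le> s" "s \<le> t" "\<bar>a - s\<bar> \<le> d" "\<bar>b - t\<bar> \<le> d"
  shows "\<bar>a / b - s / t\<bar> \<le> 2 * d / b"
proof -
  have "a / b - s / t = ((a - s) - (s / t) * (b - t)) / b"
    using assms by (simp add: field_simps)
  then have "\<bar>a / b - s / t\<bar> = \<bar>(a - s) - (s / t) * (b - t)\<bar> / b"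
    using assms by simp
  also have "\<dots> \<le> (d + 1 * d) / b"
  proof (rule divide_right_mono)
    have "\<bar>s / t\<bar> * \<bar>b - t\<bar> \<le> 1 * d" using assms by (intro mult_mono) auto
    then show "\<bar>(a - s) - (s / t) * (b - t)\<bar> \<le> d + 1 * d"
      using assms(5) abs_triangle_ineq4[of "a - s" "(s / t) * (b - t)"]
        abs_mult[of "s / t" "b - t"] by linarith
  qed (use assms in simp)
  finally show ?thesis by simp
qed

text \<open>By the geometric sum formula, since \<open>(1 - q) * sqrt n\<close> tends to
  \<open>pi / sqrt 6\<close> for \<open>q = exp (- pi / sqrt (6 * n))\<close>.\<close>

lemma sum_exp_powers_limit:
  assumes "(\<lambda>n. exp (- pi / sqrt (6 * real n)) ^ M n) \<longlonglongrightarrow> L"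
  shows "(\<lambda>n. (\<Sum>j=1..M n. exp (- pi / sqrt (6 * real n)) ^ j) / sqrt n) \<longlonglongrightarrow> sqrt 6 / pi * (1 - L)"
proof -
  define q where "q n = exp (- pi / sqrt (6 * real n))" for n
  have "(\<lambda>n. q n / ((1 - q n) * sqrt n)) \<longlonglongrightarrow> inverse pi * 6 powr (1 / 2)"
    unfolding q_def by real_asymp
  then have "(\<lambda>n. q n / ((1 - q n) * sqrt n)) \<longlonglongrightarrow> sqrt 6 / pi"
    by (simp add: powr_half_sqrt field_simps)
  from tendsto_mult[OF this tendsto_diff[OF tendsto_const assms]]
  have "(\<lambda>n. q n / ((1 - q n) * sqrt n) * (1 - q n ^ M n)) \<longlonglongrightarrow> sqrt 6 / pi * (1 - L)"
    unfolding q_def .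
  also have "?this \<longleftrightarrow> ?thesis"
  proof (rule filterlim_cong)
    show "\<forall>\<^sub>F n in sequentially. q n / ((1 - q n) * sqrt n) * (1 - q n ^ M n)
      = (\<Sum>j=1..M n. exp (- pi / sqrt (6 * real n)) ^ j) / sqrt n"
      using eventually_gt_at_top[of 0]
    proof eventually_elim
      case (elim n)
      then have "q n < 1" by (simp add: q_def)
      then have "(\<Sum>j=1..M n. q n ^ j) = q n * (1 - q n ^ M n) / (1 - q n)"
        by (simp add: sum_gp field_simps)
      then show ?case by (simp add: q_def)
    qed
  qed auto
  finally show ?thesis .
qed

theorem theorem2:
  fixes t :: real
  assumes "0 < t"
  shows "(\<lambda>n. measure_pmf.prob (procedure1 n)
            {\<omega>. pi * real (sigma1 \<omega>) / sqrt (6 * real n) \<le> t}) \<longlonglongrightarrow> 1 - exp (- t)"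
proof -
  define M where "M n = nat \<lfloor>t * sqrt (6 * real n) / pi\<rfloor>" for n
  define S where "S A n = (\<Sum>j\<in>A. exp (- pi / sqrt (6 * real n)) ^ j)" for A n
  \<comment> \<open>\<open>M n\<close> is the largest size allowed by the event. It may exceed
    \<open>n\<close> for small \<open>n\<close>, while the concentration bound needs a subset of
    \<open>{1..n}\<close>.\<close>
  define A where "A n = {1..min n (M n)}" for n
  define r where "r n m = real (card (part_sizes m \<inter> A n)) / card (part_sizes m)" for n m
  \<comment> \<open>\<open>\<kappa> * sqrt n\<close> is the asymptotic value of
    \<open>S {1..n} n\<close>, around which the number of part sizes concentrates.\<close>
  define \<kappa> where "\<kappa> = sqrt 6 / pi"
  have \<kappa>: "0 < \<kappa>" by (simp add: \<kappa>_def)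
  have M: "real (M n) \<le> t * sqrt (6 * real n) / pi" "t * sqrt (6 * real n) / pi - 1 \<le> real (M n)" for n
  proof -
    have "0 \<le> t * sqrt (6 * real n) / pi" using assms by simp
    then show "real (M n) \<le> t * sqrt (6 * real n) / pi" "t * sqrt (6 * real n) / pi - 1 \<le> real (M n)"
      unfolding M_def by linarith+
  qed
  have prob: "measure_pmf.prob (procedure1 n) {\<omega>. pi * real (sigma1 \<omega>) / sqrt (6 * real n) \<le> t}
      = (\<Sum>m\<in>partitions n. r n m) / card (partitions n)" if n: "1 \<le> n" for n
  proof -
    define I where "I = {j. pi * real j / sqrt (6 * real n) \<le> t}"
    have I: "j \<in> I \<longleftrightarrow> j \<le> M n" for j
    proof -
      have "j \<in> I \<longleftrightarrow> real j \<le> t * sqrt (6 * real n) / pi"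
        using n by (simp add: I_def field_simps)
      also have "\<dots> \<longleftrightarrow> int j \<le> \<lfloor>t * sqrt (6 * real n) / pi\<rfloor>"
        by (simp add: le_floor_iff)
      also have "\<dots> \<longleftrightarrow> j \<le> M n"
        using assms unfolding M_def by (subst nat_le_eq_zle[symmetric]) auto
      finally show ?thesis .
    qed
    have "part_sizes m \<inter> I = part_sizes m \<inter> A n" if "m \<in> partitions n" for m
      using part_sizes_subset[OF that] by (auto simp: I A_def)
    then show ?thesis
      using prob_procedure1_sigma1[OF n, of I] by (simp add: r_def I_def cong: sum.cong)
  qed
  have "(\<lambda>n. exp (- pi / sqrt (6 * real n)) ^ min n (M n)) \<longlonglongrightarrow> exp (- t)"
  proof -
    \<comment> \<open>The floor in \<open>M n\<close> shifts this exponent by at most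
      \<open>pi / sqrt (6 * n)\<close>.\<close>
    have "(\<lambda>n. - pi / sqrt (6 * real n) * M n) \<longlonglongrightarrow> - t"
    proof (rule tendsto_sandwich[OF _ _ tendsto_const])
      have "- t \<le> - pi / sqrt (6 * real n) * M n \<and>
          - pi / sqrt (6 * real n) * M n \<le> - t + pi / sqrt (6 * real n)" if "0 < n" for n
      proof -
        have s: "0 < sqrt (6 * real n)" using that by simp
        then have "pi * M n \<le> t * sqrt (6 * real n)" "t * sqrt (6 * real n) - pi \<le> pi * M n"
          using M[of n] by (simp_all add: field_simps)
        with s show ?thesis by (simp add: field_simps)
      qed
      then show "\<forall>\<^sub>F n in sequentially. - t \<le> - pi / sqrt (6 * real n) * M n"
        "\<forall>\<^sub>F n in sequentially. - pi / sqrt (6 * real n) * M n \<le> - t + pi / sqrt (6 * real n)"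
        by (auto simp: eventually_at_top_dense)
      show "(\<lambda>n. - t + pi / sqrt (6 * real n)) \<longlonglongrightarrow> - t"
        by real_asymp
    qed
    then have "(\<lambda>n. exp (- pi / sqrt (6 * real n) * M n)) \<longlonglongrightarrow> exp (- t)"
      by (rule tendsto_exp)
    moreover have "\<forall>\<^sub>F n in sequentially. t * sqrt (6 * real n) / pi \<le> n"
      using assms by real_asymp
    then have "\<forall>\<^sub>F n in sequentially. exp (- pi / sqrt (6 * real n) * M n)
        = exp (- pi / sqrt (6 * real n)) ^ min n (M n)"
    proof eventually_elim
      case (elim n)
      then have "min n (M n) = M n" using M(1)[of n] by simp
      then show ?case by (simp add: mult.commute flip: exp_of_nat_mult)
    qed
    ultimately show ?thesis by (rule Lim_transform_eventually)
  qed
  from sum_exp_powers_limit[OF this]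
  have limA: "(\<lambda>n. S (A n) n / sqrt n) \<longlonglongrightarrow> \<kappa> * (1 - exp (- t))"
    by (simp add: S_def A_def \<kappa>_def)
  have "(\<lambda>n. exp (- pi / sqrt (6 * real n)) ^ n) \<longlonglongrightarrow> 0"
  proof -
    have "(\<lambda>n. exp (real n * (- pi / sqrt (6 * real n)))) \<longlonglongrightarrow> 0" by real_asymp
    then show ?thesis by (simp only: exp_of_nat_mult)
  qed
  from sum_exp_powers_limit[OF this]
  have lim1: "(\<lambda>n. S {1..n} n / sqrt n) \<longlonglongrightarrow> \<kappa>"
    by (simp add: S_def \<kappa>_def)
  have "(\<lambda>n. (S (A n) n / sqrt n) / (S {1..n} n / sqrt n)) \<longlonglongrightarrow> \<kappa> * (1 - exp (- t)) / \<kappa>"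
    using \<kappa> by (intro tendsto_divide limA lim1) auto
  moreover have "\<forall>\<^sub>F n in sequentially. (S (A n) n / sqrt n) / (S {1..n} n / sqrt n) = S (A n) n / S {1..n} n"
    using eventually_gt_at_top[of 0] by eventually_elim simp
  ultimately have "(\<lambda>n. S (A n) n / S {1..n} n) \<longlonglongrightarrow> \<kappa> * (1 - exp (- t)) / \<kappa>"
    by (rule Lim_transform_eventually)
  then have lim: "(\<lambda>n. S (A n) n / S {1..n} n) \<longlonglongrightarrow> 1 - exp (- t)"
    using \<kappa> by simp
  show ?thesis
  proof (rule tendstoI)
    fix \<epsilon> :: real assume \<epsilon>: "0 < \<epsilon>"
    \<comment> \<open>One \<open>e\<close> each for the good partitions, the two bad sets and the
      limit of \<open>S (A n) n / S {1..n} n\<close>.\<close>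
    define e where "e = \<epsilon> / 4"
    \<comment> \<open>\<open>\<delta> \<le> \<kappa> / 4\<close> keeps the number of part sizes of a
      good partition above \<open>\<kappa> / 4 * sqrt n\<close>;
      \<open>8 * \<delta> \<le> e * \<kappa>\<close> then makes the error of the ratio at most
      \<open>e\<close>.\<close>
    define \<delta> where "\<delta> = \<kappa> * min (1 / 4) (e / 8)"
    have e: "0 < e" using \<epsilon> by (simp add: e_def)
    have \<delta>: "0 < \<delta>" "\<delta> \<le> \<kappa> / 4" "8 * \<delta> \<le> e * \<kappa>"
      using \<kappa> e by (auto simp: \<delta>_def min_def field_simps)
    have "\<forall>\<^sub>F n in sequentially. \<kappa> / 2 < S {1..n} n / sqrt n"
      using \<kappa> by (intro order_tendstoD(1)[OF lim1]) auto
    moreover have "\<forall>\<^sub>F n in sequentially. dist (S (A n) n / S {1..n} n) (1 - exp (- t)) < e"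
      by (rule tendstoD[OF lim e])
    ultimately show "\<forall>\<^sub>F n in sequentially. dist (measure_pmf.prob (procedure1 n)
        {\<omega>. pi * real (sigma1 \<omega>) / sqrt (6 * real n) \<le> t}) (1 - exp (- t)) < \<epsilon>"
      using part_count_concentration[OF \<delta>(1) e] eventually_ge_at_top[of 1]
    proof eventually_elim
      case (elim n)
      define bad where "bad X = {m \<in> partitions n.
        \<delta> * sqrt n \<le> \<bar>real (card (part_sizes m \<inter> X)) - S X n\<bar>}" for X
      define \<rho> where "\<rho> = S (A n) n / S {1..n} n"
      define p where "p = real (card (partitions n))"
      have p: "0 < p" using card_partitions_ge_one[of n] by (simp add: p_def)
      have n: "0 < sqrt n" using elim(4) by simp
      have bad: "card (bad X) \<le> e * p" if "X \<subseteq> {1..n}" for X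
        using elim(3)[rule_format, OF that] unfolding bad_def S_def p_def .
      have A: "A n \<subseteq> {1..n}" by (auto simp: A_def)
      have S0: "0 \<le> S (A n) n" "S (A n) n \<le> S {1..n} n"
        using A by (auto simp: S_def intro!: sum_nonneg sum_mono2)
      have S1: "\<kappa> / 2 * sqrt n < S {1..n} n" using elim(1) n by (simp add: field_simps)
      then have S1': "0 < S {1..n} n" using \<kappa> n by (smt (verit) mult_pos_pos half_gt_zero)
      have \<rho>: "0 \<le> \<rho>" "\<rho> \<le> 1" using S0 S1' by (auto simp: \<rho>_def)
      \<comment> \<open>On bad partitions the trivial bound 1 is absorbed by an indicator; on the
        others both counts are within \<open>\<delta> * sqrt n\<close> of their centres.\<close>
      have "\<bar>r n m - \<rho>\<bar> \<le> e + indicator (bad (A n)) m + indicator (bad {1..n}) m"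
        if m: "m \<in> partitions n" for m
      proof -
        have r: "0 \<le> r n m" "r n m \<le> 1"
          using card_mono[OF finite_part_sizes[OF m], of "part_sizes m \<inter> A n"]
          by (auto simp: r_def divide_le_eq_1)
        show ?thesis
        proof (cases "m \<in> bad (A n) \<or> m \<in> bad {1..n}")
          case True
          have "\<bar>r n m - \<rho>\<bar> \<le> 1" using r \<rho> by linarith
          then show ?thesis using True e by (auto simp: indicator_def)
        next
          case False
          have Y: "part_sizes m \<inter> {1..n} = part_sizes m" using part_sizes_subset[OF m] by auto
          let ?a = "real (card (part_sizes m \<inter> A n))" and ?b = "real (card (part_sizes m))"
          have d: "\<bar>?a - S (A n) n\<bar> \<le> \<delta> * sqrt n" "\<bar>?b - S {1..n} n\<bar> \<le> \<delta> * sqrt n"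
            using False m Y by (auto simp: bad_def)
          have "\<delta> * sqrt n \<le> \<kappa> / 4 * sqrt n" using \<delta> n by (intro mult_right_mono) auto
          then have b: "\<kappa> / 4 * sqrt n \<le> ?b" using d(2) S1 by linarith
          have b0: "0 < \<kappa> / 4 * sqrt n" using \<kappa> n by simp
          have "\<bar>r n m - \<rho>\<bar> \<le> 2 * (\<delta> * sqrt n) / ?b"
            unfolding r_def \<rho>_def using b b0 by (intro ratio_diff_le S0 S1' d) linarith
          also have "\<dots> \<le> 2 * (\<delta> * sqrt n) / (\<kappa> / 4 * sqrt n)"
            using b b0 \<delta> by (intro divide_left_mono) (auto intro!: mult_pos_pos)
          also have "\<dots> = 8 * \<delta> / \<kappa>" using n by simp
          also have "\<dots> \<le> e" using \<delta>(3) \<kappa> by (simp add: field_simps)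
          finally show ?thesis by (simp add: indicator_def)
        qed
      qed
      then have "(\<Sum>m\<in>partitions n. \<bar>r n m - \<rho>\<bar>)
          \<le> (\<Sum>m\<in>partitions n. e + indicator (bad (A n)) m + indicator (bad {1..n}) m)"
        by (rule sum_mono)
      also have "\<dots> = e * p + card (bad (A n)) + card (bad {1..n})"
        using finite_partitions[of n]
        by (simp add: sum.distrib p_def sum.If_cases indicator_def bad_def Int_def)
      also have "\<dots> \<le> 3 * e * p" using bad[OF A] bad[of "{1..n}"] by simp
      finally have "\<bar>\<Sum>m\<in>partitions n. r n m - \<rho>\<bar> \<le> 3 * e * p"
        by (rule order_trans[OF sum_abs])
      moreover have "(\<Sum>m\<in>partitions n. r n m - \<rho>) = ((\<Sum>m\<in>partitions n. r n m) / p - \<rho>) * p"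
        using p by (simp add: sum_subtractf p_def field_simps)
      ultimately have "\<bar>(\<Sum>m\<in>partitions n. r n m) / p - \<rho>\<bar> \<le> 3 * e"
        using p by (simp add: abs_mult)
      moreover have "\<bar>\<rho> - (1 - exp (- t))\<bar> < e" using elim(2) by (simp add: dist_real_def \<rho>_def)
      ultimately have "\<bar>(\<Sum>m\<in>partitions n. r n m) / p - (1 - exp (- t))\<bar> < 4 * e"
        by linarith
      then show ?case
        using prob[OF elim(4)] by (simp add: dist_real_def p_def e_def)
    qed
  qed
qed

end
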